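(* For $m=1,\dots,M$ let $\Gamma_{1,m}\ge\Gamma_{2,m}$ and put $$A_{l,m}=2^{R_{l,m}^{\min}/B_c}\ (l=1,2),\quad \Upsilon_m=\frac{A_{2,m}(A_{1,m}-1)}{\Gamma_{1,m}}+\frac{A_{2,m}-1}{\Gamma_{2,m}}.$$ Assume $A_{2,m}\ge2$ for all $m$ and $P\ge\sum_{m=1}^M\Upsilon_m$, and let $\alpha>0$ be given. Consider the problem $$\max_{\boldsymbol q}\ Q(\boldsymbol q,\alpha)\quad\text{s.t.}\quad\sum_{m=1}^Mq_m\le P,\ \ q_m\ge\Upsilon_m\ \forall m,$$ where $\boldsymbol q=(q_1,\dots,q_M)$ and $$Q(\boldsymbol q,\alpha)=\sum_{m=1}^M\left(B_c\log\frac{A_{2,m}\Gamma_{2,m}-A_{2,m}\Gamma_{1,m}+\Gamma_{1,m}\Gamma_{2,m}q_m+\Gamma_{1,m}}{A_{2,m}\Gamma_{2,m}}+R_{2,m}^{\min}\right)-\alpha\left(P_T+\sum_{m=1}^Mq_m\right).$$ The optimal solution to this problem is $$q_m^\star=\left[\frac{B_c}{\lambda+\alpha}-\frac{A_{2,m}}{\Gamma_{1,m}}+\frac{A_{2,m}}{\Gamma_{2,m}}-\frac1{\Gamma_{2,m}}\right]_{\Upsilon_m}^{\infty},\qquad m=1,\dots,M,$$ where $\lambda$ is chosen such that $\sum_{m=1}^Mq_m^\star=P$.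
   Context: Notation: $[x]_a^\infty=\max\{x,a\}$; $\log$ is the logarithm used in the definition of the data rates (its base is not specified in the source). Setting: downlink NOMA (non-orthogonal multiple access) system with $M$ channels of bandwidth $B_c>0$ and two users per channel; $\Gamma_{l,m}>0$ is the channel-to-noise ratio and $R_{l,m}^{\min}$ the quality-of-service rate threshold of user $l$ on channel $m$, $q_m$ is the power budget of channel $m$, $P$ the total power budget of the base station, $P_T$ the circuit power consumption, and $\alpha$ the parameter of the Dinkelbach-type parametrization of the energy efficiency maximization problem with quality-of-service constraints.
   Formalization: For log base b>1, λ is also required to satisfy λ ≥ (ln b − 1)α (nonnegative multiplier); such λ with Σq*=P is shown to exist when P ≤ Σq* at λ=(ln b − 1)α; for larger P the budget is slack and the optimum is q* at that λ, with Σq*<P. *)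

theory Defs
  imports "HOL-Analysis.Analysis"
begin

text \<open>
  The channels are the elements of a finite type, whose cardinality is the number of channels.
  A quantity indexed by a user \<open>l \<in> {1, 2}\<close> and a channel \<open>m\<close> is a function of \<open>l\<close> and \<open>m\<close>;
  a power allocation is a vector indexed by the channels.
\<close>

definition qosA :: "real \<Rightarrow> (nat \<Rightarrow> 'm \<Rightarrow> real) \<Rightarrow> nat \<Rightarrow> 'm \<Rightarrow> real" where
  "qosA Bc R l m = 2 powr (R l m / Bc)"

definition Upsilon :: "real \<Rightarrow> (nat \<Rightarrow> 'm \<Rightarrow> real) \<Rightarrow> (nat \<Rightarrow> 'm \<Rightarrow> real) \<Rightarrow> 'm \<Rightarrow> real" where
  "Upsilon Bc R \<Gamma> m =
     qosA Bc R 2 m * (qosA Bc R 1 m - 1) / \<Gamma> 1 m + (qosA Bc R 2 m - 1) / \<Gamma> 2 m"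

text \<open>
  The base \<open>b\<close> of the logarithm in the data rates is a parameter. For \<open>m\<close> with
  \<open>q $ m \<ge> Upsilon Bc R \<Gamma> m\<close> the argument of the logarithm is at least
  \<open>qosA Bc R 1 m > 0\<close>, so the objective is meaningful on the whole feasible set.
\<close>

definition objectiveQ ::
  "real \<Rightarrow> real \<Rightarrow> (nat \<Rightarrow> 'm \<Rightarrow> real) \<Rightarrow> (nat \<Rightarrow> 'm \<Rightarrow> real) \<Rightarrow> real \<Rightarrow> real \<Rightarrow> real ^ 'm::finite \<Rightarrow> real"
where
  "objectiveQ b Bc R \<Gamma> PT \<alpha> q =
     (\<Sum>m\<in>UNIV.
        Bc * log b
          ((qosA Bc R 2 m * \<Gamma> 2 m - qosA Bc R 2 m * \<Gamma> 1 m + \<Gamma> 1 m * \<Gamma> 2 m * q $ m + \<Gamma> 1 m)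
             / (qosA Bc R 2 m * \<Gamma> 2 m))
        + R 2 m)
     - \<alpha> * (PT + (\<Sum>m\<in>UNIV. q $ m))"

definition feasible ::
  "real \<Rightarrow> (nat \<Rightarrow> 'm \<Rightarrow> real) \<Rightarrow> (nat \<Rightarrow> 'm \<Rightarrow> real) \<Rightarrow> real \<Rightarrow> real ^ 'm::finite \<Rightarrow> bool"
where
  "feasible Bc R \<Gamma> P q \<longleftrightarrow> (\<Sum>m\<in>UNIV. q $ m) \<le> P \<and> (\<forall>m. Upsilon Bc R \<Gamma> m \<le> q $ m)"

definition qstar ::
  "real \<Rightarrow> (nat \<Rightarrow> 'm \<Rightarrow> real) \<Rightarrow> (nat \<Rightarrow> 'm \<Rightarrow> real) \<Rightarrow> real \<Rightarrow> real \<Rightarrow> real ^ 'm::finite"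
where
  "qstar Bc R \<Gamma> \<alpha> lam =
     (\<chi> m. max (Bc / (lam + \<alpha>) - qosA Bc R 2 m / \<Gamma> 1 m + qosA Bc R 2 m / \<Gamma> 2 m - 1 / \<Gamma> 2 m)
               (Upsilon Bc R \<Gamma> m))"

text \<open>
  The Lagrange multiplier \<open>\<mu> \<ge> 0\<close> of the constraint on the total power satisfies, where
  \<open>q $ m\<close> is not clipped,
  \<open>(Bc / ln b) / (q $ m + A2 / \<Gamma>1 - A2 / \<Gamma>2 + 1 / \<Gamma>2) = \<mu> + \<alpha>\<close>. With \<open>lam + \<alpha> = ln b * (\<mu> + \<alpha>)\<close>
  this is the closed form in \<open>qstar\<close>. The value of \<open>lam\<close> for \<open>\<mu> = 0\<close> is \<open>lambda_min b \<alpha>\<close>, and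
  \<open>\<mu> \<ge> 0\<close> means \<open>lam \<ge> lambda_min b \<alpha>\<close>. For the natural logarithm \<open>lam = \<mu>\<close> and
  \<open>lambda_min (exp 1) \<alpha> = 0\<close>.
\<close>

definition lambda_min :: "real \<Rightarrow> real \<Rightarrow> real" where
  "lambda_min b \<alpha> = (ln b - 1) * \<alpha>"

end

theory Submission
  imports Defs
begin

text \<open>
  In the shifted powers \<open>q $ m + channel_offset Bc R \<Gamma> m\<close> the rate of channel \<open>m\<close> is, up to a
  constant, \<open>Bc / ln b\<close> times a natural logarithm, and the lower bound \<open>Upsilon\<close> becomes the
  positive number \<open>min_level\<close>. With \<open>s = lam + \<alpha>\<close>, the vector \<open>qstar\<close> maximizes
  \<open>Bc * ln x - s * x\<close> in each channel separately, strictly by concavity. The scaled objective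
  \<open>ln b * Q\<close> differs from the sum of these functions by a constant and
  \<open>(s - ln b * \<alpha>) * (\<Sum>m\<in>UNIV. q $ m)\<close>. On the feasible set \<open>qstar\<close> also maximizes this last term
  as soon as \<open>s = ln b * \<alpha>\<close> or the total power constraint is tight. A multiplier making it tight
  exists by the intermediate value theorem, since a large \<open>lam\<close> clips every channel.
\<close>

definition channel_offset :: "real \<Rightarrow> (nat \<Rightarrow> 'm \<Rightarrow> real) \<Rightarrow> (nat \<Rightarrow> 'm \<Rightarrow> real) \<Rightarrow> 'm \<Rightarrow> real" where
  "channel_offset Bc R \<Gamma> m =
     qosA Bc R 2 m / \<Gamma> 1 m - qosA Bc R 2 m / \<Gamma> 2 m + 1 / \<Gamma> 2 m"

definition min_level :: "real \<Rightarrow> (nat \<Rightarrow> 'm \<Rightarrow> real) \<Rightarrow> (nat \<Rightarrow> 'm \<Rightarrow> real) \<Rightarrow> 'm \<Rightarrow> real" where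
  "min_level Bc R \<Gamma> m = qosA Bc R 1 m * qosA Bc R 2 m / \<Gamma> 1 m"

lemma qosA_pos [simp]: "qosA Bc R l m > 0"
  by (simp add: qosA_def)

lemma min_level_pos: "\<Gamma> 1 m > 0 \<Longrightarrow> min_level Bc R \<Gamma> m > 0"
  by (simp add: min_level_def)

lemma Upsilon_plus_offset:
  "Upsilon Bc R \<Gamma> m + channel_offset Bc R \<Gamma> m = min_level Bc R \<Gamma> m"
  by (simp add: Upsilon_def channel_offset_def min_level_def diff_divide_distrib algebra_simps)

lemma qstar_plus_offset:
  "qstar Bc R \<Gamma> \<alpha> lam $ m + channel_offset Bc R \<Gamma> m =
     max (Bc / (lam + \<alpha>)) (min_level Bc R \<Gamma> m)"
  by (simp add: qstar_def max_add_distrib_left Upsilon_plus_offset)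
    (simp add: channel_offset_def)

text \<open>The offset turns the affine argument of the logarithm into a pure multiple of the
  shifted power, so its logarithm splits.\<close>

lemma rate_argument_eq:
  assumes "\<Gamma> 1 m > 0" "\<Gamma> 2 m > 0"
  shows "(qosA Bc R 2 m * \<Gamma> 2 m - qosA Bc R 2 m * \<Gamma> 1 m + \<Gamma> 1 m * \<Gamma> 2 m * x + \<Gamma> 1 m)
             / (qosA Bc R 2 m * \<Gamma> 2 m)
         = \<Gamma> 1 m / qosA Bc R 2 m * (x + channel_offset Bc R \<Gamma> m)"
proof -
  have "qosA Bc R 2 m \<noteq> 0"
    using qosA_pos [of Bc R 2 m] by linarith
  then show ?thesis
    using assms by (simp add: channel_offset_def field_simps)
qed

lemma ln_objectiveQ:
  assumes b: "b > 1" and g: "\<And>m. \<Gamma> 1 m > 0" "\<And>m. \<Gamma> 2 m > 0"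
    and pos: "\<And>m. q $ m + channel_offset Bc R \<Gamma> m > 0"
  shows "ln b * objectiveQ b Bc R \<Gamma> PT \<alpha> q =
     (\<Sum>m\<in>UNIV. Bc * ln (q $ m + channel_offset Bc R \<Gamma> m))
     - ln b * \<alpha> * (\<Sum>m\<in>UNIV. q $ m)
     + ((\<Sum>m\<in>UNIV. Bc * ln (\<Gamma> 1 m / qosA Bc R 2 m) + ln b * R 2 m) - ln b * \<alpha> * PT)"
proof -
  let ?T = "\<lambda>m. Bc * log b (\<Gamma> 1 m / qosA Bc R 2 m * (q $ m + channel_offset Bc R \<Gamma> m)) + R 2 m"
  let ?u = "\<lambda>m. Bc * ln (q $ m + channel_offset Bc R \<Gamma> m)"
  let ?c = "\<lambda>m. Bc * ln (\<Gamma> 1 m / qosA Bc R 2 m) + ln b * R 2 m"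
  have summand: "ln b * ?T m = ?u m + ?c m" for m
  proof -
    have "ln (\<Gamma> 1 m / qosA Bc R 2 m * (q $ m + channel_offset Bc R \<Gamma> m))
        = ln (\<Gamma> 1 m / qosA Bc R 2 m) + ln (q $ m + channel_offset Bc R \<Gamma> m)"
      using g(1) [of m] pos [of m] by (intro ln_mult_pos) simp_all
    \<comment> \<open>Applied with \<open>L = ln b\<close>, this clears the base of the
      logarithm.\<close>
    moreover have "L * (Bc * ((p + r) / L) + d) = Bc * r + (Bc * p + L * d)"
      if "L \<noteq> 0" for L p r d :: real
      using that by (simp add: field_simps)
    ultimately show ?thesis
      using b by (simp only: log_def) simp
  qed
  have "ln b * (\<Sum>m\<in>UNIV. ?T m) = (\<Sum>m\<in>UNIV. ?u m + ?c m)"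
    by (simp only: sum_distrib_left summand)
  then have "ln b * (\<Sum>m\<in>UNIV. ?T m) = (\<Sum>m\<in>UNIV. ?u m) + (\<Sum>m\<in>UNIV. ?c m)"
    by (simp only: sum.distrib)
  then show ?thesis
    unfolding objectiveQ_def rate_argument_eq [where \<Gamma> = \<Gamma>, OF g] by (simp add: algebra_simps)
qed

text \<open>The tangent bound \<open>ln t \<le> t - 1\<close>, strict for
  \<open>t \<noteq> 1\<close>, is applied to the ratio \<open>t\<close> of \<open>x\<close> to the
  clipped level.\<close>

lemma clipped_level_less:
  fixes B s u x :: real
  assumes "B > 0" "s > 0" "u > 0" "x \<ge> u" "x \<noteq> max (B / s) u"
  shows "B * ln x - s * x < B * ln (max (B / s) u) - s * max (B / s) u"
proof -
  define y where "y = max (B / s) u"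
  have y: "y > 0" "x > 0"
    using assms by (auto simp: y_def)
  have "ln (x / y) \<noteq> x / y - 1"
    using ln_eq_minus_one [of "x / y"] y assms(5) by (auto simp: y_def [symmetric])
  then have "ln (x / y) < x / y - 1"
    using ln_le_minus_one [of "x / y"] y by simp
  then have "B * (ln x - ln y) < B * (x / y - 1)"
    using assms(1) y by (simp add: ln_div)
  \<comment> \<open>An unclipped \<open>y\<close> is the stationary point, so
    \<open>B / y = s\<close>. At a clipped \<open>y = u\<close> the slope \<open>B / y\<close> is at
    most \<open>s\<close>, and \<open>x - y\<close> is nonnegative.\<close>
  also have "\<dots> \<le> s * (x - y)"
  proof (cases "B / s \<ge> u")
    case True
    then have "y = B / s"
      by (simp add: y_def)
    then have "B / y = s"
      using assms by simp
    then have "B * (x / y - 1) = s * (x - y)"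
      using y by (auto simp: field_simps)
    then show ?thesis
      by simp
  next
    case False
    then have "y = u" "B \<le> s * y"
      using assms by (simp_all add: y_def field_simps)
    have "B / y * (x - y) \<le> s * (x - y)"
      using \<open>B \<le> s * y\<close> y \<open>y = u\<close> assms(4) by (intro mult_right_mono) (simp_all add: field_simps)
    then show ?thesis
      using y by (simp add: field_simps)
  qed
  finally show ?thesis
    by (simp add: y_def [symmetric] algebra_simps)
qed

lemma is_arg_max_iff_unique:
  fixes f :: "'a \<Rightarrow> 'b::order"
  assumes "P x" "\<And>y. P y \<Longrightarrow> y \<noteq> x \<Longrightarrow> f y < f x"
  shows "is_arg_max f P q \<longleftrightarrow> q = x"
  using assms unfolding is_arg_max_def by (metis less_asym)

text \<open>Assumption \<open>slack\<close> is complementary slackness: the multiplier of the power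
  constraint vanishes or the constraint is tight.\<close>

lemma qstar_unique_arg_max:
  fixes q :: "real ^ 'm::finite"
  assumes b: "b > 1" and Bc: "Bc > 0"
    and g: "\<And>m. \<Gamma> 1 m > 0" "\<And>m. \<Gamma> 2 m > 0"
    and \<alpha>: "\<alpha> > 0" and lam: "lam \<ge> lambda_min b \<alpha>"
    and sum_le: "(\<Sum>m\<in>UNIV. qstar Bc R \<Gamma> \<alpha> lam $ m) \<le> P"
    and slack: "lam = lambda_min b \<alpha> \<or> (\<Sum>m\<in>UNIV. qstar Bc R \<Gamma> \<alpha> lam $ m) = P"
  shows "is_arg_max (objectiveQ b Bc R \<Gamma> PT \<alpha>) (feasible Bc R \<Gamma> P) q \<longleftrightarrow> q = qstar Bc R \<Gamma> \<alpha> lam"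
proof (rule is_arg_max_iff_unique)
  let ?q = "qstar Bc R \<Gamma> \<alpha> lam"
  let ?o = "channel_offset Bc R \<Gamma>"
  define s where "s = lam + \<alpha>"
  \<comment> \<open>The difference \<open>s - ln b * \<alpha>\<close> is \<open>ln b\<close> times
    the multiplier of the power constraint.\<close>
  have s_ge: "s \<ge> ln b * \<alpha>"
    using lam by (simp add: s_def lambda_min_def algebra_simps)
  moreover have "ln b * \<alpha> > 0"
    using b \<alpha> by simp
  ultimately have s: "s > 0"
    by linarith
  show feas: "feasible Bc R \<Gamma> P ?q"
    using sum_le by (auto simp: feasible_def qstar_def)
  fix y
  assume y: "feasible Bc R \<Gamma> P y" and ne: "y \<noteq> ?q"
  have lower: "q $ m + ?o m \<ge> min_level Bc R \<Gamma> m" if "feasible Bc R \<Gamma> P q" for q m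
    using that by (simp add: feasible_def flip: Upsilon_plus_offset)
  have pos: "q $ m + ?o m > 0" if "feasible Bc R \<Gamma> P q" for q m
    using lower [OF that, of m] min_level_pos [where \<Gamma> = \<Gamma> and Bc = Bc and R = R, OF g(1), of m] by linarith
  \<comment> \<open>Up to constants, \<open>F\<close> is the contribution of one channel to the
    Lagrangian scaled by \<open>ln b\<close>.\<close>
  define F where "F q m = Bc * ln (q $ m + ?o m) - s * (q $ m + ?o m)" for q :: "real ^ 'm" and m
  have F_less: "F y m < F ?q m" if "y $ m \<noteq> ?q $ m" for m
    using clipped_level_less [OF Bc s min_level_pos [where \<Gamma> = \<Gamma>, OF g(1)] lower [OF y], of m] that
    by (simp add: F_def qstar_plus_offset flip: s_def)
      (metis add_right_cancel qstar_plus_offset s_def)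
  have "(\<Sum>m\<in>UNIV. F y m) < (\<Sum>m\<in>UNIV. F ?q m)"
  proof (rule sum_strict_mono_ex1)
    show "\<forall>m\<in>UNIV. F y m \<le> F ?q m"
    proof
      fix m
      show "F y m \<le> F ?q m"
        using F_less [of m] by (cases "y $ m = ?q $ m") (simp_all add: F_def)
    qed
    show "\<exists>m\<in>UNIV. F y m < F ?q m"
      using ne F_less by (auto simp: vec_eq_iff)
  qed simp
  moreover have "(s - ln b * \<alpha>) * (\<Sum>m\<in>UNIV. y $ m) \<le> (s - ln b * \<alpha>) * (\<Sum>m\<in>UNIV. ?q $ m)"
    using slack
  proof
    assume "lam = lambda_min b \<alpha>"
    then show ?thesis
      by (simp add: s_def lambda_min_def algebra_simps)
  next
    assume "(\<Sum>m\<in>UNIV. ?q $ m) = P"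
    then show ?thesis
      using y s_ge by (intro mult_left_mono) (simp_all add: feasible_def)
  qed
  \<comment> \<open>The offset terms in \<open>F\<close> and the constants from
    \<open>ln_objectiveQ\<close> agree on both sides and cancel.\<close>
  ultimately have "ln b * objectiveQ b Bc R \<Gamma> PT \<alpha> y < ln b * objectiveQ b Bc R \<Gamma> PT \<alpha> ?q"
    by (simp add: ln_objectiveQ [OF b g pos [OF y]] ln_objectiveQ [OF b g pos [OF feas]]
        F_def sum_subtractf sum.distrib distrib_left left_diff_distrib flip: sum_distrib_left)
  then show "objectiveQ b Bc R \<Gamma> PT \<alpha> y < objectiveQ b Bc R \<Gamma> PT \<alpha> ?q"
    using b by simp
qed

lemma exists_tight_multiplier:
  fixes \<Gamma> R :: "nat \<Rightarrow> 'm::finite \<Rightarrow> real"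
  assumes Bc: "Bc > 0" and g: "\<And>m. \<Gamma> 1 m > 0"
    and lower: "(\<Sum>m\<in>UNIV. Upsilon Bc R \<Gamma> m) \<le> P" and l0: "l0 + \<alpha> > 0"
    and upper: "P \<le> (\<Sum>m\<in>UNIV. qstar Bc R \<Gamma> \<alpha> l0 $ m)"
  shows "\<exists>lam \<ge> l0. (\<Sum>m\<in>UNIV. qstar Bc R \<Gamma> \<alpha> lam $ m) = P"
proof -
  \<comment> \<open>Channel \<open>m\<close> is clipped once \<open>lam + \<alpha>\<close> reaches
    \<open>Bc / min_level Bc R \<Gamma> m\<close>. The sum of these positive thresholds dominates
    each of them.\<close>
  define d where "d = (\<Sum>m\<in>UNIV. Bc / min_level Bc R \<Gamma> m)"
  have u: "min_level Bc R \<Gamma> m > 0" for m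
    using g by (rule min_level_pos)
  have d: "Bc / min_level Bc R \<Gamma> m \<le> d" for m
    unfolding d_def using Bc u by (intro member_le_sum) (auto simp: less_imp_le)
  have "d \<ge> 0"
    unfolding d_def using Bc u by (intro sum_nonneg) (simp add: less_imp_le)
  have "qstar Bc R \<Gamma> \<alpha> (l0 + d) $ m = Upsilon Bc R \<Gamma> m" for m
  proof -
    have "Bc / min_level Bc R \<Gamma> m \<le> l0 + d + \<alpha>"
      using d [of m] l0 by linarith
    then have "Bc / (l0 + d + \<alpha>) \<le> min_level Bc R \<Gamma> m"
      using u [of m] l0 \<open>d \<ge> 0\<close> by (simp add: field_simps)
    then have "qstar Bc R \<Gamma> \<alpha> (l0 + d) $ m + channel_offset Bc R \<Gamma> m
        = Upsilon Bc R \<Gamma> m + channel_offset Bc R \<Gamma> m"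
      by (simp add: qstar_plus_offset Upsilon_plus_offset)
    then show ?thesis
      by simp
  qed
  then have "(\<Sum>m\<in>UNIV. qstar Bc R \<Gamma> \<alpha> (l0 + d) $ m) \<le> P"
    using lower by simp
  \<comment> \<open>The denominator \<open>lam + \<alpha>\<close> stays positive on the interval
    because \<open>l0 + \<alpha> > 0\<close>.\<close>
  moreover have "continuous_on {l0..l0 + d} (\<lambda>lam. \<Sum>m\<in>UNIV. qstar Bc R \<Gamma> \<alpha> lam $ m)"
    unfolding qstar_def using l0 by (auto intro!: continuous_intros)
  ultimately show ?thesis
    using IVT2' [of "\<lambda>lam. \<Sum>m\<in>UNIV. qstar Bc R \<Gamma> \<alpha> lam $ m" "l0 + d" P l0] upper \<open>d \<ge> 0\<close>
    by auto
qed

theorem theorem5: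
  fixes b Bc P PT \<alpha> :: real
    and \<Gamma> R :: "nat \<Rightarrow> 'm::finite \<Rightarrow> real"
  assumes "b > 1"
    and "Bc > 0"
    and "\<And>l m. l \<in> {1, 2} \<Longrightarrow> \<Gamma> l m > 0"
    and "\<And>m. \<Gamma> 1 m \<ge> \<Gamma> 2 m"
    and "\<And>m. qosA Bc R 2 m \<ge> 2"
    and "P \<ge> (\<Sum>m\<in>UNIV. Upsilon Bc R \<Gamma> m)"
    and "\<alpha> > 0"
  shows "(\<forall>lam \<ge> lambda_min b \<alpha>. (\<Sum>m\<in>UNIV. qstar Bc R \<Gamma> \<alpha> lam $ m) = P \<longrightarrow>
           (\<forall>q. is_arg_max (objectiveQ b Bc R \<Gamma> PT \<alpha>) (feasible Bc R \<Gamma> P) q \<longleftrightarrow>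
                q = qstar Bc R \<Gamma> \<alpha> lam))
     \<and> (P \<le> (\<Sum>m\<in>UNIV. qstar Bc R \<Gamma> \<alpha> (lambda_min b \<alpha>) $ m) \<longrightarrow>
           (\<exists>lam \<ge> lambda_min b \<alpha>. (\<Sum>m\<in>UNIV. qstar Bc R \<Gamma> \<alpha> lam $ m) = P))
     \<and> ((\<Sum>m\<in>UNIV. qstar Bc R \<Gamma> \<alpha> (lambda_min b \<alpha>) $ m) < P \<longrightarrow>
           (\<forall>q. is_arg_max (objectiveQ b Bc R \<Gamma> PT \<alpha>) (feasible Bc R \<Gamma> P) q \<longleftrightarrow>
                q = qstar Bc R \<Gamma> \<alpha> (lambda_min b \<alpha>)))"
proof -
  have g: "\<And>m. \<Gamma> 1 m > 0" "\<And>m. \<Gamma> 2 m > 0"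
    using assms(3) by simp_all
  have "lambda_min b \<alpha> + \<alpha> > 0"
    using assms(1,7) by (simp add: lambda_min_def algebra_simps)
  \<comment> \<open>The first and third claims are the two alternatives of \<open>slack\<close>; the
    second takes \<open>l0 = lambda_min b \<alpha>\<close>.\<close>
  with assms(6) show ?thesis
    by (simp add: qstar_unique_arg_max [OF assms(1,2) g assms(7)]
        exists_tight_multiplier [where \<Gamma> = \<Gamma>, OF assms(2) g(1)])
qed

end
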